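(* Let $m \geq 2$, let $\mu \in \mathbb{R}\setminus\{0\}$, and let $D \subset \mathbb{R}^m$ be a domain. If $u$ is $\mu$-panharmonic in $D$, then \[ \lim_{r \to +0} \frac{M^\bullet(u,x,r) - u(x)}{r^2} = \frac{\mu^2 u(x)}{2(m+2)} \quad \text{for every } x \in D, \] and also \[ \lim_{r \to +0} \frac{M^\circ(u,x,r) - u(x)}{r^2} = \frac{\mu^2 u(x)}{2m} \quad \text{for every } x \in D. \]
   Context: A domain is a connected open set. A real-valued function $u \in C^2(D)$ is called $\mu$-panharmonic in $D$ if $\nabla^2 u - \mu^2 u = 0$ in $D$, where $\nabla^2$ is the Laplacian. $B_r(x)$ is the open ball of radius $r$ centred at $x$ and $S_r(x)=\partial B_r(x)$. For $\overline{B_r(x)} \subset D$, $M^\bullet(u,x,r) = |B_r|^{-1}\int_{B_r(x)} u(y)\,dy$ is the volume mean ($|B_r|$ is the volume of the ball) and $M^\circ(u,x,r) = |S_r|^{-1}\int_{S_r(x)} u(y)\,dS_y$ is the spherical mean ($|S_r|$ is the surface area of the sphere of radius $r$). *)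

theory Defs
  imports "HOL-Analysis.Analysis"
begin

text \<open>The partial derivative along a coordinate direction is read off from the Frechet derivative;
  it is used only for functions that are differentiable at the point.\<close>

definition partial_deriv :: "'a::euclidean_space \<Rightarrow> ('a \<Rightarrow> real) \<Rightarrow> 'a \<Rightarrow> real" where
  "partial_deriv b f x = frechet_derivative f (at x) b"

text \<open>Intended for open sets \<open>D\<close>.\<close>

definition C2_on :: "'a::euclidean_space set \<Rightarrow> ('a \<Rightarrow> real) \<Rightarrow> bool" where
  "C2_on D f \<longleftrightarrow>
     f differentiable_on D \<and>
     (\<forall>b\<in>Basis. partial_deriv b f differentiable_on D) \<and>
     (\<forall>b\<in>Basis. \<forall>c\<in>Basis. continuous_on D (partial_deriv c (partial_deriv b f)))"

definition laplacian :: "('a::euclidean_space \<Rightarrow> real) \<Rightarrow> 'a \<Rightarrow> real" where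
  "laplacian f x = (\<Sum>b\<in>Basis. partial_deriv b (partial_deriv b f) x)"

definition panharmonic :: "real \<Rightarrow> 'a::euclidean_space set \<Rightarrow> ('a \<Rightarrow> real) \<Rightarrow> bool" where
  "panharmonic \<mu> D u \<longleftrightarrow> C2_on D u \<and> (\<forall>x\<in>D. laplacian u x - \<mu>\<^sup>2 * u x = 0)"

definition volume_mean :: "('a::euclidean_space \<Rightarrow> real) \<Rightarrow> 'a \<Rightarrow> real \<Rightarrow> real" where
  "volume_mean u x r = (LINT y:ball x r|lborel. u y) / measure lborel (ball x r)"

text \<open>The surface measure on the sphere of radius \<open>r > 0\<close>, in the standard form used for polar
  coordinates: on the unit sphere, \<open>\<sigma>(A)\<close> is \<open>m\<close> times the volume of the part of the open unit ball
  lying over \<open>A\<close> (the cone \<open>{t a | a \<in> A, 0 < t < 1}\<close>); it is then moved to \<open>sphere x r\<close> and multiplied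
  by \<open>r ^ (m - 1)\<close>. See \<open>emeasure_sphere_measure\<close> for the explicit formula and
  \<open>measure_sphere_measure_sphere\<close> for the total area.\<close>

definition sphere_measure :: "'a::euclidean_space \<Rightarrow> real \<Rightarrow> 'a measure" where
  "sphere_measure x r =
     scale_measure (ennreal (real DIM('a) * r ^ (DIM('a) - 1)))
       (distr (restrict_space lborel (ball 0 1 - {0})) (restrict_space borel (sphere x r))
          (\<lambda>y. x + r *\<^sub>R sgn y))"

definition spherical_mean :: "('a::euclidean_space \<Rightarrow> real) \<Rightarrow> 'a \<Rightarrow> real \<Rightarrow> real" where
  "spherical_mean u x r =
     (LINT y|sphere_measure x r. u y) / measure (sphere_measure x r) (sphere x r)"

lemma space_sphere_measure [simp]: "space (sphere_measure x r) = sphere x r"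
  by (simp add: sphere_measure_def space_scale_measure space_restrict_space)

lemma sets_sphere_measure [simp]:
  "sets (sphere_measure x r) = sets (restrict_space borel (sphere x r))"
  by (simp add: sphere_measure_def)

lemma measurable_sphere_projection:
  fixes x :: "'a::euclidean_space"
  assumes "r > 0"
  shows "(\<lambda>y. x + r *\<^sub>R sgn y)
    \<in> restrict_space lborel (ball 0 1 - {0}) \<rightarrow>\<^sub>M restrict_space borel (sphere x r)"
proof (rule measurable_restrict_space2)
  show "(\<lambda>y. x + r *\<^sub>R sgn y) \<in> space (restrict_space lborel (ball 0 1 - {0})) \<rightarrow> sphere x r"
    using assms by (auto simp: space_restrict_space dist_norm norm_sgn)
  show "(\<lambda>y. x + r *\<^sub>R sgn y) \<in> restrict_space lborel (ball 0 1 - {0}) \<rightarrow>\<^sub>M borel"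
    by (rule measurable_restrict_space1) (unfold sgn_div_norm, measurable)
qed

text \<open>The area of a piece \<open>A\<close> of the sphere is \<open>m / r\<close> times the volume of the cone with
  apex at the centre \<open>x\<close> and base \<open>A\<close>.\<close>

lemma emeasure_sphere_measure:
  fixes x :: "'a::euclidean_space"
  assumes r: "r > 0" and A: "A \<in> sets borel" "A \<subseteq> sphere x r"
  shows "emeasure (sphere_measure x r) A =
    ennreal (real DIM('a) / r) * emeasure lborel {x + t *\<^sub>R (a - x) | t a. a \<in> A \<and> 0 < t \<and> t < 1}"
proof -
  let ?f = "\<lambda>y. x + r *\<^sub>R sgn y" and ?B = "ball 0 1 - {0} :: 'a set"
  define P where "P = ?f -` A \<inter> ?B"
  have A': "A \<in> sets (restrict_space borel (sphere x r))"
    using A by (auto simp: sets_restrict_space)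
  have "P \<in> sets (restrict_space lborel ?B)"
    using measurable_sets[OF measurable_sphere_projection[OF r] A']
    by (simp add: P_def space_restrict_space)
  then have P: "P \<in> sets borel"
    by (subst (asm) sets_restrict_space_iff) auto
  have cone: "{x + t *\<^sub>R (a - x) | t a. a \<in> A \<and> 0 < t \<and> t < 1} = (\<lambda>y. x + r *\<^sub>R y) ` P"
  proof (intro equalityI subsetI)
    fix z assume "z \<in> {x + t *\<^sub>R (a - x) | t a. a \<in> A \<and> 0 < t \<and> t < 1}"
    then obtain t a where ta: "z = x + t *\<^sub>R (a - x)" "a \<in> A" "0 < t" "t < 1"
      by blast
    have na: "norm (a - x) = r"
      using A(2) ta(2) by (auto simp: dist_norm norm_minus_commute)
    define y where "y = (t / r) *\<^sub>R (a - x)"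
    have ny: "norm y = t"
      using r ta na by (simp add: y_def)
    have "r *\<^sub>R sgn y = a - x"
      using r ta ny by (simp add: sgn_div_norm) (simp add: y_def)
    then have "y \<in> P"
      using ny ta by (auto simp: P_def)
    moreover have "z = x + r *\<^sub>R y"
      using r ta by (simp add: y_def)
    ultimately show "z \<in> (\<lambda>y. x + r *\<^sub>R y) ` P"
      by blast
  next
    fix z assume "z \<in> (\<lambda>y. x + r *\<^sub>R y) ` P"
    then obtain y where y: "y \<in> P" "z = x + r *\<^sub>R y"
      by blast
    have "z = x + norm y *\<^sub>R (?f y - x)" "?f y \<in> A" "0 < norm y" "norm y < 1"
      using y by (auto simp: P_def sgn_div_norm)
    then show "z \<in> {x + t *\<^sub>R (a - x) | t a. a \<in> A \<and> 0 < t \<and> t < 1}"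
      by blast
  qed
  have "emeasure (sphere_measure x r) A =
      ennreal (real DIM('a) * r ^ (DIM('a) - 1)) * emeasure lborel P"
    using A' measurable_sphere_projection[OF r, of x]
    by (simp add: sphere_measure_def emeasure_distr emeasure_restrict_space space_restrict_space P_def)
  moreover have "emeasure lborel ((\<lambda>y. x + r *\<^sub>R y) ` P) = ennreal (r ^ DIM('a)) * emeasure lborel P"
  proof -
    have "(\<lambda>y. x + r *\<^sub>R y) ` P = (\<lambda>z. (z - x) /\<^sub>R r) -` P"
    proof (intro equalityI subsetI)
      fix z assume "z \<in> (\<lambda>z. (z - x) /\<^sub>R r) -` P"
      then show "z \<in> (\<lambda>y. x + r *\<^sub>R y) ` P"
        using r by (intro image_eqI[of _ _ "(z - x) /\<^sub>R r"]) auto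
    qed (use r in auto)
    moreover have "(\<lambda>z. (z - x) /\<^sub>R r) \<in> borel \<rightarrow>\<^sub>M borel"
      by measurable
    ultimately have "(\<lambda>y. x + r *\<^sub>R y) ` P \<in> sets borel"
      using measurable_sets[OF _ P, of "\<lambda>z. (z - x) /\<^sub>R r" borel] by simp
    then show ?thesis
      using emeasure_lebesgue_affine[of r x P] r P
      by (simp add: add.commute ennreal_power)
  qed
  moreover have "ennreal (real DIM('a) * r ^ (DIM('a) - 1)) =
      ennreal (real DIM('a) / r) * ennreal (r ^ DIM('a))"
  proof -
    have "real DIM('a) * r ^ (DIM('a) - 1) = real DIM('a) / r * r ^ DIM('a)"
      using r by (simp add: power_eq_if)
    then show ?thesis
      using r by (metis ennreal_mult divide_nonneg_pos of_nat_0_le_iff zero_le_power less_imp_le)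
  qed
  ultimately show ?thesis
    unfolding cone by (metis mult.assoc)
qed

lemma measure_sphere_measure_sphere:
  fixes x :: "'a::euclidean_space"
  assumes r: "r > 0"
  shows "measure (sphere_measure x r) (sphere x r) =
    real DIM('a) * unit_ball_vol (real DIM('a)) * r ^ (DIM('a) - 1)"
proof -
  let ?B = "ball 0 1 - {0} :: 'a set"
  have "sphere x r \<in> sets (restrict_space borel (sphere x r))"
    by (auto simp: sets_restrict_space)
  moreover have "(\<lambda>y. x + r *\<^sub>R sgn y) -` sphere x r \<inter> ?B = ?B"
    using r by (auto simp: dist_norm norm_sgn)
  ultimately have "emeasure (sphere_measure x r) (sphere x r) =
      ennreal (real DIM('a) * r ^ (DIM('a) - 1)) * emeasure lborel ?B"
    using measurable_sphere_projection[OF r, of x]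
    by (simp add: sphere_measure_def emeasure_distr emeasure_restrict_space space_restrict_space)
  also have "emeasure lborel ?B = emeasure lborel (ball 0 1 :: 'a set)"
    using AE_lborel_singleton[of "0 :: 'a"] by (intro emeasure_eq_AE) auto
  also have "\<dots> = ennreal (unit_ball_vol (real DIM('a)))"
    by (simp add: emeasure_ball)
  finally show ?thesis
    using r by (simp add: measure_def enn2real_mult)
qed

end

theory Submission
  imports Defs
begin

text \<open>Let \<open>m\<close> be the dimension. Both means are averages over the unit ball \<open>B\<close> with
Lebesgue measure: up to the factor \<open>1 / |B|\<close>, the volume mean is the integral of \<open>u (x + r *\<^sub>R y)\<close> and the spherical mean is the integral of
\<open>u (x + r *\<^sub>R sgn y)\<close>, because the surface measure is, up to a constant factor, the image
of Lebesgue measure on \<open>B\<close> under central projection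
(\<open>volume_mean_eq_unit_ball\<close>, \<open>spherical_mean_eq_unit_ball\<close>). So in both cases
\<open>u\<close> is averaged at \<open>x + r *\<^sub>R \<phi> y\<close> for a radial field \<open>\<phi> y = g (norm y) *\<^sub>R y\<close> with \<open>norm (\<phi> y) \<le> 1\<close>.

Insert the second order Taylor expansion of \<open>u\<close> at \<open>x\<close> (\<open>second_order_taylor\<close>) and integrate term by
term. The linear terms and the mixed quadratic terms vanish because Lebesgue measure on \<open>B\<close> is
invariant under reflecting one coordinate; the pure squares all have the same integral because
this measure is invariant under swapping two coordinates, and that integral is \<open>1 / m\<close> times the integral of
\<open>(norm (\<phi> y))\<^sup>2\<close> (\<open>radial_moments\<close>). What survives at order \<open>r\<^sup>2\<close> is the Laplacian of \<open>u\<close> at \<open>x\<close>,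
multiplied by \<open>s / (2 m)\<close>, where \<open>s\<close> is the average of \<open>(norm (\<phi> y))\<^sup>2\<close> over \<open>B\<close>. On the sphere
\<open>s = 1\<close>; on the ball \<open>s = m / (m + 2)\<close> (\<open>integral_norm_square_ball\<close>). This gives the limits
for every \<open>C\<^sup>2\<close> function (\<open>mean_limits_C2\<close>), and panharmonicity replaces the Laplacian by
\<open>\<mu>\<^sup>2 * u x\<close>.\<close>

section \<open>Second order Taylor expansion\<close>

lemma has_derivative_partials:
  fixes f :: "'a::euclidean_space \<Rightarrow> real"
  assumes "f differentiable (at x)"
  shows "(f has_derivative (\<lambda>h. \<Sum>b\<in>Basis. (h \<bullet> b) * partial_deriv b f x)) (at x)"
proof -
  have D: "(f has_derivative frechet_derivative f (at x)) (at x)"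
    using assms by (simp add: frechet_derivative_works)
  then have lin: "linear (frechet_derivative f (at x))"
    by (rule has_derivative_linear)
  have "frechet_derivative f (at x) h = (\<Sum>b\<in>Basis. (h \<bullet> b) * partial_deriv b f x)" for h
  proof -
    have "frechet_derivative f (at x) h = frechet_derivative f (at x) (\<Sum>b\<in>Basis. (h \<bullet> b) *\<^sub>R b)"
      by (simp add: euclidean_representation)
    also have "\<dots> = (\<Sum>b\<in>Basis. (h \<bullet> b) * partial_deriv b f x)"
      by (simp add: linear_sum[OF lin] linear_scale[OF lin] partial_deriv_def)
    finally show ?thesis .
  qed
  then have "frechet_derivative f (at x) = (\<lambda>h. \<Sum>b\<in>Basis. (h \<bullet> b) * partial_deriv b f x)"
    by (rule ext)
  with D show ?thesis by simp
qed

text \<open>Along the segment from \<open>x\<close> to \<open>x + h\<close> the derivative of \<open>t \<mapsto> u (x + t *\<^sub>R h)\<close> is the sum over \<open>b\<close> of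
\<open>h \<bullet> b\<close> times the partial derivative in direction \<open>b\<close>. Each of these partial derivatives is
differentiable at \<open>x\<close>, so it is affine in \<open>t\<close> up to \<open>o(norm h)\<close>, and the mean value theorem turns the
first order estimate for the derivative into the second order estimate for \<open>u\<close>.\<close>

lemma second_order_taylor:
  fixes u :: "'a::euclidean_space \<Rightarrow> real"
  assumes D: "open D" "x \<in> D" and u: "u differentiable_on D"
    and pu: "\<And>b. b \<in> Basis \<Longrightarrow> partial_deriv b u differentiable (at x)"
    and e: "e > 0"
  shows "\<exists>d>0. \<forall>h. norm h \<le> d \<longrightarrow>
    \<bar>u (x + h) - u x - (\<Sum>b\<in>Basis. (h \<bullet> b) * partial_deriv b u x)
      - (\<Sum>b\<in>Basis. \<Sum>c\<in>Basis. (h \<bullet> b) * (h \<bullet> c) * partial_deriv c (partial_deriv b u) x) / 2\<bar>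
      \<le> e * (norm h)\<^sup>2"
proof -
  \<comment> \<open>The error is summed over the coordinate directions, which share \<open>e\<close> equally.\<close>
  define e' where "e' = e / real DIM('a)"
  have e': "e' > 0" using e by (simp add: e'_def)
  define L where "L b h = (\<Sum>c\<in>Basis. (h \<bullet> c) * partial_deriv c (partial_deriv b u) x)" for b h
  have "\<forall>\<^sub>F y in nhds x. \<bar>partial_deriv b u y - partial_deriv b u x - L b (y - x)\<bar> \<le> e' * norm (y - x)"
    if "b \<in> Basis" for b
  proof -
    have "(partial_deriv b u has_derivative L b) (at x)"
      unfolding L_def by (rule has_derivative_partials[OF pu[OF that]])
    then show ?thesis
      using e' unfolding has_derivative_at_alt eventually_nhds_metric dist_norm real_norm_def by meson
  qed
  then have "\<forall>\<^sub>F y in nhds x. \<forall>b\<in>Basis.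
      \<bar>partial_deriv b u y - partial_deriv b u x - L b (y - x)\<bar> \<le> e' * norm (y - x)"
    by (intro eventually_ball_finite) auto
  moreover have "\<forall>\<^sub>F y in nhds x. y \<in> D"
    using D by (rule eventually_nhds_in_open)
  ultimately have "\<forall>\<^sub>F y in nhds x. y \<in> D \<and> (\<forall>b\<in>Basis.
      \<bar>partial_deriv b u y - partial_deriv b u x - L b (y - x)\<bar> \<le> e' * norm (y - x))"
    by eventually_elim auto
  then obtain d where d: "d > 0" and
    near: "\<And>y. dist y x < d \<Longrightarrow> y \<in> D"
    "\<And>y b. dist y x < d \<Longrightarrow> b \<in> Basis \<Longrightarrow>
      \<bar>partial_deriv b u y - partial_deriv b u x - L b (y - x)\<bar> \<le> e' * norm (y - x)"
    unfolding eventually_nhds_metric by blast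
  have "\<bar>u (x + h) - u x - (\<Sum>b\<in>Basis. (h \<bullet> b) * partial_deriv b u x)
      - (\<Sum>b\<in>Basis. \<Sum>c\<in>Basis. (h \<bullet> b) * (h \<bullet> c) * partial_deriv c (partial_deriv b u) x) / 2\<bar>
      \<le> e * (norm h)\<^sup>2" if h: "norm h \<le> d / 2" for h
  proof -
    define A where "A = (\<Sum>b\<in>Basis. (h \<bullet> b) * partial_deriv b u x)"
    define Q where "Q = (\<Sum>b\<in>Basis. (h \<bullet> b) * L b h)"
    \<comment> \<open>\<open>\<psi> 1 - \<psi> 0\<close> is the Taylor remainder.\<close>
    define \<psi> where "\<psi> t = u (x + t *\<^sub>R h) - t * A - t\<^sup>2 / 2 * Q" for t
    define \<psi>' where "\<psi>' t = (\<Sum>b\<in>Basis. (h \<bullet> b) *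
        (partial_deriv b u (x + t *\<^sub>R h) - partial_deriv b u x - t * L b h))" for t
    have close: "dist (x + t *\<^sub>R h) x < d" if "0 \<le> t" "t \<le> 1" for t
    proof -
      have "t * norm h \<le> 1 * norm h" using that by (intro mult_right_mono) auto
      then show ?thesis using that h d by (simp add: dist_norm)
    qed
    have deriv: "(\<psi> has_real_derivative \<psi>' t) (at t)" if t: "0 \<le> t" "t \<le> 1" for t
    proof -
      have "u differentiable (at (x + t *\<^sub>R h))"
        using u near(1)[OF close[OF t]] D(1)
        unfolding differentiable_on_def by (metis at_within_open)
      then have du: "(u has_derivative (\<lambda>k. \<Sum>b\<in>Basis. (k \<bullet> b) * partial_deriv b u (x + t *\<^sub>R h)))
          (at (x + t *\<^sub>R h))"
        by (rule has_derivative_partials)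
      have "((\<lambda>t. u (x + t *\<^sub>R h)) has_derivative
          (\<lambda>s. \<Sum>b\<in>Basis. ((s *\<^sub>R h) \<bullet> b) * partial_deriv b u (x + t *\<^sub>R h))) (at t)"
        by (rule has_derivative_compose[where f = "\<lambda>t. x + t *\<^sub>R h" and f' = "\<lambda>s. s *\<^sub>R h", OF _ du])
           (auto intro!: derivative_eq_intros)
      then have "((\<lambda>t. u (x + t *\<^sub>R h)) has_real_derivative
          (\<Sum>b\<in>Basis. (h \<bullet> b) * partial_deriv b u (x + t *\<^sub>R h))) (at t)"
        unfolding has_field_derivative_def
        by (rule has_derivative_eq_rhs) (simp add: fun_eq_iff sum_distrib_left sum_distrib_right mult_ac)
      then have "(\<psi> has_real_derivative
          (\<Sum>b\<in>Basis. (h \<bullet> b) * partial_deriv b u (x + t *\<^sub>R h)) - A - t * Q) (at t)"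
        unfolding \<psi>_def by (auto intro!: derivative_eq_intros)
      also have "(\<Sum>b\<in>Basis. (h \<bullet> b) * partial_deriv b u (x + t *\<^sub>R h)) - A - t * Q = \<psi>' t"
        by (simp add: \<psi>'_def A_def Q_def right_diff_distrib sum_subtractf sum_distrib_left mult_ac)
      finally show ?thesis .
    qed
    obtain t where t: "0 < t" "t < 1" "\<psi> 1 - \<psi> 0 = \<psi>' t"
      using MVT2[of 0 1 \<psi> \<psi>'] deriv by auto
    have "\<bar>\<psi>' t\<bar> \<le> (\<Sum>b\<in>(Basis::'a set). norm h * (e' * norm h))"
      unfolding \<psi>'_def
    proof (rule order_trans[OF sum_abs sum_mono])
      fix b :: 'a assume b: "b \<in> Basis"
      have "L b (t *\<^sub>R h) = t * L b h"
        by (simp add: L_def sum_distrib_left mult_ac)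
      then have "\<bar>partial_deriv b u (x + t *\<^sub>R h) - partial_deriv b u x - t * L b h\<bar> \<le> e' * norm (t *\<^sub>R h)"
        using near(2)[OF close b, of t] t by simp
      also have "\<dots> \<le> e' * (1 * norm h)"
        using t e' by (simp add: mult_left_mono mult_left_le_one_le)
      finally show "\<bar>(h \<bullet> b) * (partial_deriv b u (x + t *\<^sub>R h) - partial_deriv b u x - t * L b h)\<bar>
          \<le> norm h * (e' * norm h)"
        using Basis_le_norm[OF b, of h] by (auto simp: abs_mult intro!: mult_mono)
    qed
    also have "\<dots> = e * (norm h)\<^sup>2"
      by (simp add: e'_def power2_eq_square)
    finally have "\<bar>\<psi> 1 - \<psi> 0\<bar> \<le> e * (norm h)\<^sup>2" using t by simp
    moreover have "Q = (\<Sum>b\<in>Basis. \<Sum>c\<in>Basis. (h \<bullet> b) * (h \<bullet> c) * partial_deriv c (partial_deriv b u) x)"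
      by (simp add: Q_def L_def sum_distrib_left mult.assoc)
    ultimately show ?thesis by (simp add: \<psi>_def A_def)
  qed
  moreover have "d / 2 > 0" using d by simp
  ultimately show ?thesis by blast
qed

section \<open>Averages over isotropic distributions\<close>

text \<open>Under the moment assumptions, integrating the Taylor polynomial of \<open>v\<close> leaves only the constant term
and the pure second derivatives, and the remainder contributes at most \<open>e * r\<^sup>2\<close> times the total mass.
The Taylor estimate bounds \<open>v (x + r *\<^sub>R \<phi> y)\<close> for small \<open>r\<close>, which makes it integrable in \<open>y\<close>.\<close>

lemma isotropic_mean_expansion:
  fixes v :: "'a::euclidean_space \<Rightarrow> real" and \<phi> :: "'b \<Rightarrow> 'a"
  assumes M: "finite_measure M"
    and \<phi>[measurable]: "\<phi> \<in> borel_measurable M" and v[measurable]: "v \<in> borel_measurable borel"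
    and bound: "\<And>y. y \<in> space M \<Longrightarrow> norm (\<phi> y) \<le> 1"
    and first: "\<And>b. b \<in> Basis \<Longrightarrow> (LINT y|M. \<phi> y \<bullet> b) = 0"
    and second: "\<And>b c. b \<in> Basis \<Longrightarrow> c \<in> Basis \<Longrightarrow>
      (LINT y|M. (\<phi> y \<bullet> b) * (\<phi> y \<bullet> c)) = (if b = c then \<kappa> else 0)"
    and taylor: "\<And>e. e > 0 \<Longrightarrow> \<exists>d>0. \<forall>h. norm h \<le> d \<longrightarrow>
      \<bar>v (x + h) - v x - (\<Sum>b\<in>Basis. (h \<bullet> b) * p b)
        - (\<Sum>b\<in>Basis. \<Sum>c\<in>Basis. (h \<bullet> b) * (h \<bullet> c) * q b c) / 2\<bar> \<le> e * (norm h)\<^sup>2"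
  shows "((\<lambda>r. ((LINT y|M. v (x + r *\<^sub>R \<phi> y)) - measure M (space M) * v x) / r\<^sup>2)
    \<longlongrightarrow> \<kappa> / 2 * (\<Sum>b\<in>Basis. q b b)) (at_right 0)"
proof (rule tendstoI)
  interpret finite_measure M by fact
  fix \<epsilon> :: real assume \<epsilon>: "\<epsilon> > 0"
  define \<omega> where "\<omega> = measure M (space M)"
  \<comment> \<open>The extra \<open>1\<close> keeps \<open>e\<close> well defined if the total mass \<open>\<omega>\<close> is zero and makes \<open>e * \<omega> < \<epsilon>\<close> strict.\<close>
  define e where "e = \<epsilon> / (\<omega> + 1)"
  have \<omega>: "\<omega> \<ge> 0" by (simp add: \<omega>_def)
  then have e: "e > 0" and e\<omega>: "e * \<omega> < \<epsilon>" using \<epsilon> by (auto simp: e_def field_simps)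
  define P where "P h = v x + (\<Sum>b\<in>Basis. (h \<bullet> b) * p b)
        + (\<Sum>b\<in>Basis. \<Sum>c\<in>Basis. (h \<bullet> b) * (h \<bullet> c) * q b c) / 2" for h
  from taylor[OF e] obtain d where d: "d > 0"
    and R: "\<And>h. norm h \<le> d \<Longrightarrow> \<bar>v (x + h) - P h\<bar> \<le> e * (norm h)\<^sup>2"
    unfolding P_def by (auto simp: algebra_simps)
  have comp: "\<bar>\<phi> y \<bullet> b\<bar> \<le> 1" if "y \<in> space M" "b \<in> Basis" for y b
    using Basis_le_norm[OF that(2), of "\<phi> y"] bound[OF that(1)] by linarith
  have int1: "integrable M (\<lambda>y. \<phi> y \<bullet> b)" if "b \<in> Basis" for b
    using comp that by (intro integrable_const_bound[where B = 1] AE_I2) auto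
  have int2: "integrable M (\<lambda>y. (\<phi> y \<bullet> b) * (\<phi> y \<bullet> c))" if "b \<in> Basis" "c \<in> Basis" for b c
    using comp that
    by (intro integrable_const_bound[where B = 1] AE_I2) (auto simp: abs_mult intro!: mult_le_one)
  have Pr: "P (r *\<^sub>R \<phi> y) = v x + (\<Sum>b\<in>Basis. (r * p b) * (\<phi> y \<bullet> b))
      + (\<Sum>b\<in>Basis. \<Sum>c\<in>Basis. (r\<^sup>2 * q b c / 2) * ((\<phi> y \<bullet> b) * (\<phi> y \<bullet> c)))" for r y
    by (simp add: P_def sum_divide_distrib power2_eq_square mult_ac)
  have intP: "integrable M (\<lambda>y. P (r *\<^sub>R \<phi> y))" for r
    unfolding Pr using int1 int2 by (intro Bochner_Integration.integrable_add
        Bochner_Integration.integrable_sum integrable_mult_right) auto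
  have IP: "(LINT y|M. P (r *\<^sub>R \<phi> y)) = \<omega> * v x + r\<^sup>2 * (\<kappa> / 2 * (\<Sum>b\<in>Basis. q b b))" for r
  proof -
    have "(LINT y|M. P (r *\<^sub>R \<phi> y)) = \<omega> * v x + (\<Sum>b\<in>Basis. (r * p b) * (LINT y|M. \<phi> y \<bullet> b))
      + (\<Sum>b\<in>Basis. \<Sum>c\<in>Basis. (r\<^sup>2 * q b c / 2) * (LINT y|M. (\<phi> y \<bullet> b) * (\<phi> y \<bullet> c)))"
      unfolding Pr using int1 int2
      by (simp add: integral_add integral_sum integrable_sum \<omega>_def del: times_divide_eq_left times_divide_eq_right)
    also have "\<dots> = \<omega> * v x + (\<Sum>b\<in>Basis. r\<^sup>2 * q b b / 2 * \<kappa>)"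
      by (simp add: first second if_distrib[of "\<lambda>z. _ * z"] sum.delta cong: if_cong sum.cong)
    finally show ?thesis by (simp add: sum_distrib_left mult_ac)
  qed
  have "dist (((LINT y|M. v (x + r *\<^sub>R \<phi> y)) - \<omega> * v x) / r\<^sup>2) (\<kappa> / 2 * (\<Sum>b\<in>Basis. q b b)) < \<epsilon>"
    if r: "0 < r" "r < d" for r
  proof -
    have Rr: "\<bar>v (x + r *\<^sub>R \<phi> y) - P (r *\<^sub>R \<phi> y)\<bar> \<le> e * r\<^sup>2" if y: "y \<in> space M" for y
    proof -
      have n: "norm (r *\<^sub>R \<phi> y) \<le> r"
        using r bound[OF y] by (simp add: mult_left_le)
      then have "\<bar>v (x + r *\<^sub>R \<phi> y) - P (r *\<^sub>R \<phi> y)\<bar> \<le> e * (norm (r *\<^sub>R \<phi> y))\<^sup>2"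
        using r by (intro R) linarith
      also have "\<dots> \<le> e * r\<^sup>2"
        using n e by (intro mult_left_mono power_mono) auto
      finally show ?thesis .
    qed
    have [measurable]: "(\<lambda>y. P (r *\<^sub>R \<phi> y)) \<in> borel_measurable M"
      using intP by (rule borel_measurable_integrable)
    have intR: "integrable M (\<lambda>y. v (x + r *\<^sub>R \<phi> y) - P (r *\<^sub>R \<phi> y))"
    proof (rule integrable_const_bound)
      show "AE y in M. norm (v (x + r *\<^sub>R \<phi> y) - P (r *\<^sub>R \<phi> y)) \<le> e * r\<^sup>2"
        using Rr by (intro AE_I2) simp
    qed measurable
    have "(LINT y|M. v (x + r *\<^sub>R \<phi> y))
        = (LINT y|M. (v (x + r *\<^sub>R \<phi> y) - P (r *\<^sub>R \<phi> y)) + P (r *\<^sub>R \<phi> y))"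
      by simp
    also have "\<dots> = (LINT y|M. v (x + r *\<^sub>R \<phi> y) - P (r *\<^sub>R \<phi> y)) + (LINT y|M. P (r *\<^sub>R \<phi> y))"
      using intR intP by (rule Bochner_Integration.integral_add)
    finally have split: "(LINT y|M. v (x + r *\<^sub>R \<phi> y)) - \<omega> * v x - r\<^sup>2 * (\<kappa> / 2 * (\<Sum>b\<in>Basis. q b b))
        = (LINT y|M. v (x + r *\<^sub>R \<phi> y) - P (r *\<^sub>R \<phi> y))"
      using IP[of r] by simp
    have "\<bar>LINT y|M. v (x + r *\<^sub>R \<phi> y) - P (r *\<^sub>R \<phi> y)\<bar> \<le> (LINT y|M. e * r\<^sup>2)"
      using intR Rr
      by (intro order_trans[OF integral_abs_bound integral_mono] integrable_abs integrable_const)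
    also have "\<dots> = (e * \<omega>) * r\<^sup>2" by (simp add: \<omega>_def)
    also have "\<dots> < \<epsilon> * r\<^sup>2" using e\<omega> r by simp
    finally have "\<bar>(LINT y|M. v (x + r *\<^sub>R \<phi> y)) - \<omega> * v x - r\<^sup>2 * (\<kappa> / 2 * (\<Sum>b\<in>Basis. q b b))\<bar> / r\<^sup>2 < \<epsilon>"
      using r unfolding split by (simp add: divide_less_eq)
    also have "\<bar>(LINT y|M. v (x + r *\<^sub>R \<phi> y)) - \<omega> * v x - r\<^sup>2 * (\<kappa> / 2 * (\<Sum>b\<in>Basis. q b b))\<bar> / r\<^sup>2
        = \<bar>((LINT y|M. v (x + r *\<^sub>R \<phi> y)) - \<omega> * v x - r\<^sup>2 * (\<kappa> / 2 * (\<Sum>b\<in>Basis. q b b))) / r\<^sup>2\<bar>"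
      by simp
    also have "\<dots> = \<bar>((LINT y|M. v (x + r *\<^sub>R \<phi> y)) - \<omega> * v x) / r\<^sup>2 - \<kappa> / 2 * (\<Sum>b\<in>Basis. q b b)\<bar>"
      using r by (simp add: diff_divide_distrib)
    finally show ?thesis by (simp add: dist_real_def)
  qed
  then show "\<forall>\<^sub>F r in at_right 0. dist (((LINT y|M. v (x + r *\<^sub>R \<phi> y)) - measure M (space M) * v x) / r\<^sup>2)
      (\<kappa> / 2 * (\<Sum>b\<in>Basis. q b b)) < \<epsilon>"
    using d unfolding \<omega>_def[symmetric] by (intro eventually_at_rightI[of 0 d]) auto
qed

section \<open>Symmetries of Lebesgue measure and moments of radial fields\<close>

lemma distr_lborel_reflection:
  fixes b :: "'a::euclidean_space"
  assumes b: "b \<in> Basis"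
  shows "distr lborel borel (\<lambda>y. y - (2 * (y \<bullet> b)) *\<^sub>R b) = lborel"
proof -
  define c where "c j = (if j = b then -1 else 1 :: real)" for j :: 'a
  have coord: "(\<Sum>j\<in>Basis. (c j * (y \<bullet> j)) *\<^sub>R j) \<bullet> i = c i * (y \<bullet> i)" if "i \<in> Basis" for y i
    using that by (simp add: inner_sum_left inner_Basis if_distrib cong: if_cong)
  have "y - (2 * (y \<bullet> b)) *\<^sub>R b = 0 + (\<Sum>j\<in>Basis. (c j * (y \<bullet> j)) *\<^sub>R j)" for y
  proof (rule euclidean_eqI)
    fix i :: 'a assume i: "i \<in> Basis"
    have "(y - (2 * (y \<bullet> b)) *\<^sub>R b) \<bullet> i = c i * (y \<bullet> i)"
      using b i by (simp add: c_def inner_diff_left inner_Basis)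
    then show "(y - (2 * (y \<bullet> b)) *\<^sub>R b) \<bullet> i = (0 + (\<Sum>j\<in>Basis. (c j * (y \<bullet> j)) *\<^sub>R j)) \<bullet> i"
      using coord[OF i] by simp
  qed
  then have "(\<lambda>y. y - (2 * (y \<bullet> b)) *\<^sub>R b) = (\<lambda>y. 0 + (\<Sum>j\<in>Basis. (c j * (y \<bullet> j)) *\<^sub>R j))"
    by (rule ext)
  moreover have "(\<Prod>j\<in>Basis. \<bar>c j\<bar>) = 1"
    by (intro prod.neutral) (auto simp: c_def)
  ultimately show ?thesis
    using lborel_affine_euclidean[of c 0] by (simp add: c_def density_1)
qed

text \<open>The preimage of a box is the box with permuted side lengths, which has the same volume, and the
volumes of boxes determine Lebesgue measure.\<close>

lemma distr_lborel_permute_coordinates: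
  fixes \<tau> :: "'a::euclidean_space \<Rightarrow> 'a"
  assumes \<tau>: "\<And>j. j \<in> Basis \<Longrightarrow> \<tau> j \<in> Basis" "\<And>j. j \<in> Basis \<Longrightarrow> \<tau> (\<tau> j) = j"
  shows "distr lborel borel (\<lambda>y. \<Sum>j\<in>Basis. (y \<bullet> \<tau> j) *\<^sub>R j) = lborel"
    (is "distr _ _ ?T = _")
proof (rule lborel_eqI[symmetric])
  have \<tau>_Basis: "\<tau> ` Basis = Basis"
  proof (rule subset_antisym)
    show "\<tau> ` Basis \<subseteq> Basis" using \<tau>(1) by blast
    show "Basis \<subseteq> \<tau> ` Basis" using \<tau> by (metis image_eqI subsetI)
  qed
  have Tj: "?T y \<bullet> j = y \<bullet> \<tau> j" if "j \<in> Basis" for y j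
    using that by (simp add: inner_sum_left inner_Basis if_distrib cong: if_cong)
  fix l u :: 'a assume le: "\<And>j. j \<in> Basis \<Longrightarrow> l \<bullet> j \<le> u \<bullet> j"
  have vim: "?T -` box l u = box (?T l) (?T u)"
  proof (intro set_eqI)
    fix y
    have "y \<in> ?T -` box l u \<longleftrightarrow> (\<forall>j\<in>Basis. l \<bullet> j < y \<bullet> \<tau> j \<and> y \<bullet> \<tau> j < u \<bullet> j)"
      by (simp add: mem_box Tj)
    also have "\<dots> \<longleftrightarrow> (\<forall>j\<in>\<tau> ` Basis. l \<bullet> j < y \<bullet> \<tau> j \<and> y \<bullet> \<tau> j < u \<bullet> j)"
      using \<tau>_Basis by simp
    also have "\<dots> \<longleftrightarrow> y \<in> box (?T l) (?T u)"
      by (simp add: mem_box Tj \<tau>)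
    finally show "y \<in> ?T -` box l u \<longleftrightarrow> y \<in> box (?T l) (?T u)" .
  qed
  have "emeasure (distr lborel borel ?T) (box l u) = emeasure lborel (box (?T l) (?T u))"
    by (simp add: emeasure_distr vim)
  also have "\<dots> = (\<Prod>j\<in>Basis. (?T u - ?T l) \<bullet> j)"
    using le \<tau>(1) by (intro emeasure_lborel_box) (auto simp: Tj)
  also have "(\<Prod>j\<in>Basis. (?T u - ?T l) \<bullet> j) = (\<Prod>j\<in>Basis. (u - l) \<bullet> \<tau> j)"
    by (intro prod.cong) (auto simp: inner_diff_left Tj)
  also have "\<dots> = (\<Prod>j\<in>Basis. (u - l) \<bullet> j)"
    using \<tau> by (intro prod.reindex_bij_witness[of _ \<tau> \<tau>]) auto
  finally show "emeasure (distr lborel borel ?T) (box l u) = (\<Prod>j\<in>Basis. (u - l) \<bullet> j)" .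
qed simp

lemma ball_integral_invariant:
  fixes T :: "'a::euclidean_space \<Rightarrow> 'a" and F :: "'a \<Rightarrow> real"
  assumes T[measurable]: "T \<in> borel_measurable borel" and lb: "distr lborel borel T = lborel"
    and n: "\<And>y. norm (T y) = norm y"
    and F[measurable]: "F \<in> borel_measurable borel"
  shows "(LINT y|restrict_space lborel (ball 0 1). F (T y)) = (LINT y|restrict_space lborel (ball 0 1). F y)"
proof -
  have "(\<lambda>y. indicator (ball 0 1) y * F y) \<in> borel_measurable borel" using F by (intro borel_measurable_times borel_measurable_indicator) auto
  then have FB: "(\<lambda>y. indicator (ball 0 1) y *\<^sub>R F y) \<in> borel_measurable borel" by simp
  have "(LINT y|restrict_space lborel (ball 0 1). F y) = (LINT y|distr lborel borel T. indicator (ball 0 1) y *\<^sub>R F y)"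
    by (simp add: lb integral_restrict_space)
  also have "\<dots> = (LINT y|lborel. indicator (ball 0 1) (T y) *\<^sub>R F (T y))"
    using FB by (intro integral_distr) auto
  also have "\<dots> = (LINT y|restrict_space lborel (ball 0 1). F (T y))"
    by (simp add: integral_restrict_space indicator_def n)
  finally show ?thesis ..
qed

text \<open>A reflection of coordinate \<open>b\<close> commutes with a radial field and changes the sign of its
\<open>b\<close>-component only, so the first moments and the mixed second moments equal their own negatives.
Swapping coordinates shows that all pure second moments agree; since they add up to the integral of
the squared norm, each of them is that integral divided by the dimension.\<close>

lemma radial_moments:
  fixes g :: "real \<Rightarrow> real"
  defines "M \<equiv> restrict_space lborel (ball 0 1 :: 'a::euclidean_space set)"
  assumes g[measurable]: "g \<in> borel_measurable borel"
    and bound: "\<And>y::'a. norm y < 1 \<Longrightarrow> norm (g (norm y) *\<^sub>R y) \<le> 1"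
    and b: "b \<in> Basis" and c: "c \<in> Basis"
  shows "(LINT y|M. (g (norm y) *\<^sub>R y) \<bullet> b) = 0"
    and "(LINT y|M. ((g (norm y) *\<^sub>R y) \<bullet> b) * ((g (norm y) *\<^sub>R y) \<bullet> c))
      = (if b = c then (LINT y|M. (norm (g (norm y) *\<^sub>R y))\<^sup>2) / DIM('a) else 0)"
proof -
  define S where "S b y = y - (2 * (y \<bullet> b)) *\<^sub>R b" for b y :: 'a
  have Sj: "S b y \<bullet> j = (if j = b then - (y \<bullet> j) else y \<bullet> j)" if "b \<in> Basis" "j \<in> Basis" for b j y
    using that by (auto simp: S_def inner_diff_left inner_Basis)
  have S: "S b \<in> borel_measurable borel" "distr lborel borel (S b) = lborel"
    "norm (S b y) = norm y" if "b \<in> Basis" for b y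
  proof -
    show "S b \<in> borel_measurable borel" unfolding S_def by measurable
    show "distr lborel borel (S b) = lborel"
      unfolding S_def by (rule distr_lborel_reflection[OF that])
    have "S b y \<bullet> S b y = (\<Sum>j\<in>Basis. (S b y \<bullet> j) * (S b y \<bullet> j))" by (rule euclidean_inner)
    also have "\<dots> = (\<Sum>j\<in>Basis. (y \<bullet> j) * (y \<bullet> j))" by (intro sum.cong) (auto simp: Sj[OF that])
    also have "\<dots> = y \<bullet> y" by (rule euclidean_inner[symmetric])
    finally show "norm (S b y) = norm y" by (simp add: norm_eq)
  qed
  show "(LINT y|M. (g (norm y) *\<^sub>R y) \<bullet> b) = 0"
    using ball_integral_invariant[OF S[OF b], of "\<lambda>y. (g (norm y) *\<^sub>R y) \<bullet> b"]
    by (simp add: M_def S(3) Sj b)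
  have mixed: "(LINT y|M. ((g (norm y) *\<^sub>R y) \<bullet> b) * ((g (norm y) *\<^sub>R y) \<bullet> c)) = 0" if "b \<noteq> c"
    using ball_integral_invariant[OF S[OF b], of "\<lambda>y. ((g (norm y) *\<^sub>R y) \<bullet> b) * ((g (norm y) *\<^sub>R y) \<bullet> c)"] that
    by (simp add: M_def S(3) Sj b c)
  have diag: "(LINT y|M. ((g (norm y) *\<^sub>R y) \<bullet> b)\<^sup>2) = (LINT y|M. ((g (norm y) *\<^sub>R y) \<bullet> c)\<^sup>2)"
    if b: "b \<in> Basis" and c: "c \<in> Basis" for b c
  proof -
    define T where "T y = (\<Sum>j\<in>Basis. (y \<bullet> Transposition.transpose b c j) *\<^sub>R j)" for y :: 'a
    have Tj: "T y \<bullet> j = y \<bullet> Transposition.transpose b c j" if "j \<in> Basis" for y j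
      using that by (simp add: T_def inner_sum_left inner_Basis if_distrib cong: if_cong)
    have "norm (T y) = norm y" for y
    proof -
      have "T y \<bullet> T y = (\<Sum>j\<in>Basis. (y \<bullet> Transposition.transpose b c j) * (y \<bullet> Transposition.transpose b c j))"
        by (subst euclidean_inner) (simp add: Tj)
      also have "\<dots> = (\<Sum>j\<in>Basis. (y \<bullet> j) * (y \<bullet> j))"
        using b c by (intro sum.reindex_bij_witness[of _ "Transposition.transpose b c" "Transposition.transpose b c"])
          (auto simp: Transposition.transpose_def)
      also have "\<dots> = y \<bullet> y" by (rule euclidean_inner[symmetric])
      finally show ?thesis by (simp add: norm_eq)
    qed
    moreover have "T \<in> borel_measurable borel" unfolding T_def by measurable
    moreover have "distr lborel borel T = lborel"
      unfolding T_def using b c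
      by (intro distr_lborel_permute_coordinates) (auto simp: Transposition.transpose_def)
    ultimately show ?thesis
      using ball_integral_invariant[of T "\<lambda>y. ((g (norm y) *\<^sub>R y) \<bullet> c)\<^sup>2"] Tj[OF c] by (simp add: M_def)
  qed
  interpret finite_measure M
    unfolding M_def
    by (rule finite_measureI) (auto simp: space_restrict_space emeasure_restrict_space emeasure_ball)
  have int: "integrable M (\<lambda>y. ((g (norm y) *\<^sub>R y) \<bullet> j)\<^sup>2)" if j: "j \<in> Basis" for j
  proof (intro integrable_const_bound[where B = 1] AE_I2)
    fix y assume "y \<in> space M"
    then have "norm y < 1" by (simp add: M_def space_restrict_space)
    then have "\<bar>(g (norm y) *\<^sub>R y) \<bullet> j\<bar> \<le> 1"
      using bound[of y] Basis_le_norm[OF j, of "g (norm y) *\<^sub>R y"] by linarith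
    then show "norm (((g (norm y) *\<^sub>R y) \<bullet> j)\<^sup>2) \<le> 1"
      by (simp add: abs_square_le_1)
  qed (unfold M_def, rule measurable_restrict_space1, simp)
  have norm_sq: "(norm z)\<^sup>2 = (\<Sum>j\<in>Basis. (z \<bullet> j)\<^sup>2)" for z :: 'a
    by (simp only: power2_norm_eq_inner euclidean_inner[of z z]) (simp only: power2_eq_square)
  have "(LINT y|M. (norm (g (norm y) *\<^sub>R y))\<^sup>2) = (LINT y|M. (\<Sum>j\<in>Basis. ((g (norm y) *\<^sub>R y) \<bullet> j)\<^sup>2))"
    by (simp only: norm_sq)
  also have "\<dots> = (\<Sum>j\<in>Basis. (LINT y|M. ((g (norm y) *\<^sub>R y) \<bullet> j)\<^sup>2))"
    using int by (rule Bochner_Integration.integral_sum)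
  also have "\<dots> = (\<Sum>j\<in>(Basis::'a set). (LINT y|M. ((g (norm y) *\<^sub>R y) \<bullet> b)\<^sup>2))"
    by (intro sum.cong refl diag b)
  finally have "(LINT y|M. ((g (norm y) *\<^sub>R y) \<bullet> b)\<^sup>2) = (LINT y|M. (norm (g (norm y) *\<^sub>R y))\<^sup>2) / DIM('a)"
    by simp
  with mixed show "(LINT y|M. ((g (norm y) *\<^sub>R y) \<bullet> b) * ((g (norm y) *\<^sub>R y) \<bullet> c))
      = (if b = c then (LINT y|M. (norm (g (norm y) *\<^sub>R y))\<^sup>2) / DIM('a) else 0)"
    by (auto simp: power2_eq_square)
qed

section \<open>The mean squared norm on the unit ball\<close>

lemma integral_lborel_scale:
  fixes f :: "'a::euclidean_space \<Rightarrow> real"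
  assumes [measurable]: "f \<in> borel_measurable borel" and r: "r > 0"
  shows "(LINT y|lborel. f y) = r ^ DIM('a) * (LINT y|lborel. f (x + r *\<^sub>R y))"
proof -
  have "(LINT y|lborel. f y)
      = (LINT y|density (distr lborel borel (\<lambda>y. x + r *\<^sub>R y)) (\<lambda>_. ennreal (r ^ DIM('a))). f y)"
    using lborel_affine[of r x] r by simp
  also have "\<dots> = (LINT y|distr lborel borel (\<lambda>y. x + r *\<^sub>R y). r ^ DIM('a) *\<^sub>R f y)"
    using r by (intro integral_density) auto
  also have "\<dots> = r ^ DIM('a) * (LINT y|lborel. f (x + r *\<^sub>R y))"
    by (simp add: integral_distr)
  finally show ?thesis .
qed

text \<open>Let \<open>m\<close> be the dimension, \<open>\<omega>\<close> the volume of the unit ball, and \<open>J r\<close> the integral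
of \<open>(norm y)\<^sup>2\<close> over the ball of radius \<open>r\<close>. On the thin shell between
the radii \<open>r < 1\<close> and \<open>1\<close> the integrand lies between \<open>r\<^sup>2\<close> and \<open>1\<close>, so \<open>J 1 - J r\<close> lies between
\<open>r\<^sup>2\<close> times the volume of the shell and that volume, which is \<open>\<omega> * (1 - r ^ m)\<close>. By scaling,
\<open>J 1 - J r = J 1 * (1 - r ^ (m + 2))\<close>. Dividing by \<open>1 - r\<close> and letting \<open>r\<close> tend to \<open>1\<close> gives
\<open>J 1 * (m + 2) = \<omega> * m\<close>.\<close>

lemma integral_norm_square_ball:
  "(LINT y|restrict_space lborel (ball 0 1 :: 'a::euclidean_space set). (norm y)\<^sup>2)
    = real DIM('a) * unit_ball_vol (real DIM('a)) / (real DIM('a) + 2)"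
proof -
  define m \<omega> where "m = DIM('a)" and "\<omega> = unit_ball_vol (real DIM('a))"
  define J where "J r = (LINT y|lborel. indicator (ball 0 r) y * (norm (y::'a))\<^sup>2)" for r :: real
  have intJ: "integrable lborel (\<lambda>y::'a. indicator (ball 0 r) y * (norm y)\<^sup>2)" for r :: real
  proof -
    have "set_integrable lborel (cball (0::'a) r) (\<lambda>y. (norm y)\<^sup>2)"
      unfolding set_integrable_def by (intro borel_integrable_compact) (auto intro!: continuous_intros)
    then have "set_integrable lborel (ball (0::'a) r) (\<lambda>y. (norm y)\<^sup>2)"
      by (rule set_integrable_subset) auto
    then show ?thesis by (simp add: set_integrable_def)
  qed
  have intB: "integrable lborel (indicator (ball (0::'a) r) :: 'a \<Rightarrow> real)" for r :: real
    by (cases "r \<ge> 0") (auto simp: integrable_indicator_iff emeasure_ball ball_empty)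
  have K: "(LINT y|lborel. indicator (ball (0::'a) r) y) = \<omega> * r ^ m" if "r > 0" for r :: real
    using that by (simp add: content_ball m_def \<omega>_def)
  have scale: "J r = r ^ (m + 2) * J 1" if r: "r > 0" for r
  proof -
    have "J r = r ^ m * (LINT y|lborel. indicator (ball 0 r) (0 + r *\<^sub>R y) * (norm (0 + r *\<^sub>R (y::'a)))\<^sup>2)"
      unfolding J_def m_def using borel_measurable_integrable[OF intJ[of r]]
      by (intro integral_lborel_scale r) simp
    also have "(\<lambda>y::'a. indicator (ball 0 r) (0 + r *\<^sub>R y) * (norm (0 + r *\<^sub>R y))\<^sup>2)
        = (\<lambda>y. r\<^sup>2 * (indicator (ball 0 1) y * (norm y)\<^sup>2))"
      using r by (auto simp: indicator_def power_mult_distrib)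
    also have "(LINT y|lborel. r\<^sup>2 * (indicator (ball 0 1) y * (norm (y::'a))\<^sup>2)) = r\<^sup>2 * J 1"
      unfolding J_def by (rule integral_mult_right_zero)
    finally show ?thesis by (simp add: power_add power2_eq_square)
  qed
  have annulus: "r\<^sup>2 * (\<omega> * (1 - r ^ m)) \<le> J 1 - J r" "J 1 - J r \<le> \<omega> * (1 - r ^ m)"
    if r: "0 < r" "r < 1" for r
  proof -
    let ?ind = "\<lambda>y::'a. indicator (ball 0 1) y - indicator (ball 0 r) y :: real"
    have J: "J 1 - J r = (LINT y|lborel. ?ind y * (norm y)\<^sup>2)"
      using Bochner_Integration.integral_diff[OF intJ[of 1] intJ[of r]]
      by (simp add: J_def left_diff_distrib)
    have intI: "integrable lborel (\<lambda>y. ?ind y * (norm y)\<^sup>2)"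
      using Bochner_Integration.integrable_diff[OF intJ[of 1] intJ[of r]]
      by (simp add: left_diff_distrib)
    have intV: "integrable lborel ?ind"
      using intB by (intro Bochner_Integration.integrable_diff)
    have V: "\<omega> * (1 - r ^ m) = (LINT y|lborel. ?ind y)"
      using Bochner_Integration.integral_diff[OF intB[of 1] intB[of r]] K[of 1] K[of r] r
      by (simp only: right_diff_distrib) simp
    have "(LINT y|lborel. r\<^sup>2 * ?ind y) \<le> (LINT y|lborel. ?ind y * (norm y)\<^sup>2)"
      by (rule integral_mono[OF integrable_mult_right[OF intV] intI])
         (use r in \<open>auto simp: indicator_def intro!: power_mono\<close>)
    then show "r\<^sup>2 * (\<omega> * (1 - r ^ m)) \<le> J 1 - J r"
      unfolding J V by (simp only: integral_mult_right_zero)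
    show "J 1 - J r \<le> \<omega> * (1 - r ^ m)"
      unfolding J V
      by (rule integral_mono[OF intI intV])
         (use r in \<open>auto simp: indicator_def intro!: power_le_one\<close>)
  qed
  \<comment> \<open>Geometric sums carry out the division by \<open>1 - r\<close> and stay continuous at \<open>r = 1\<close>.\<close>
  have geo: "1 - r ^ k = (1 - r) * (\<Sum>i<k. r ^ i)" for r :: real and k
    by (rule one_diff_power_eq)
  have squeeze: "r\<^sup>2 * (\<omega> * (\<Sum>i<m. r ^ i)) \<le> J 1 * (\<Sum>i<m+2. r ^ i)"
    "J 1 * (\<Sum>i<m+2. r ^ i) \<le> \<omega> * (\<Sum>i<m. r ^ i)" if r: "0 < r" "r < 1" for r
  proof -
    have J: "J 1 - J r = (1 - r) * (J 1 * (\<Sum>i<m+2. r ^ i))"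
    proof -
      have "J 1 - J r = J 1 * (1 - r ^ (m + 2))"
        using scale[OF r(1)] by (simp add: algebra_simps)
      then show ?thesis by (simp only: geo mult_ac)
    qed
    have "(1 - r) * (r\<^sup>2 * (\<omega> * (\<Sum>i<m. r ^ i))) \<le> (1 - r) * (J 1 * (\<Sum>i<m+2. r ^ i))"
      using annulus(1)[OF r] unfolding J geo[of r m] by (simp only: mult_ac)
    then show "r\<^sup>2 * (\<omega> * (\<Sum>i<m. r ^ i)) \<le> J 1 * (\<Sum>i<m+2. r ^ i)"
      using r by (simp only: mult_le_cancel_left_pos diff_gt_0_iff_gt)
    have "(1 - r) * (J 1 * (\<Sum>i<m+2. r ^ i)) \<le> (1 - r) * (\<omega> * (\<Sum>i<m. r ^ i))"
      using annulus(2)[OF r] unfolding J geo[of r m] by (simp only: mult_ac)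
    then show "J 1 * (\<Sum>i<m+2. r ^ i) \<le> \<omega> * (\<Sum>i<m. r ^ i)"
      using r by (simp only: mult_le_cancel_left_pos diff_gt_0_iff_gt)
  qed
  have near: "\<forall>\<^sub>F r in at_left 1. 0 < r \<and> r < (1::real)"
    by (rule eventually_at_leftI[of 0]) auto
  have lim: "((\<lambda>r::real. \<Sum>i<k. r ^ i) \<longlongrightarrow> real k) (at_left 1)" for k
  proof -
    have "((\<lambda>r::real. \<Sum>i<k. r ^ i) \<longlongrightarrow> (\<Sum>i<k. 1 ^ i)) (at_left 1)"
      by (intro tendsto_intros)
    then show ?thesis by simp
  qed
  have low: "((\<lambda>r::real. r\<^sup>2 * (\<omega> * (\<Sum>i<m. r ^ i))) \<longlongrightarrow> 1\<^sup>2 * (\<omega> * real m)) (at_left 1)"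
    by (intro tendsto_intros lim)
  have mid: "((\<lambda>r::real. J 1 * (\<Sum>i<m+2. r ^ i)) \<longlongrightarrow> J 1 * real (m + 2)) (at_left 1)"
    by (intro tendsto_intros lim)
  have high: "((\<lambda>r::real. \<omega> * (\<Sum>i<m. r ^ i)) \<longlongrightarrow> \<omega> * real m) (at_left 1)"
    by (intro tendsto_intros lim)
  have "1\<^sup>2 * (\<omega> * real m) \<le> J 1 * real (m + 2)"
    using eventually_mono[OF near] squeeze(1) by (intro tendsto_le[OF _ mid low]) auto
  moreover have "J 1 * real (m + 2) \<le> \<omega> * real m"
    using eventually_mono[OF near] squeeze(2) by (intro tendsto_le[OF _ high mid]) auto
  ultimately have "J 1 * (real m + 2) = real m * \<omega>" by (simp add: algebra_simps)
  then have "J 1 = real m * \<omega> / (real m + 2)" by (simp add: field_simps)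
  then show ?thesis
    by (simp add: J_def m_def \<omega>_def integral_restrict_space)
qed

section \<open>Volume and spherical means as integrals over the unit ball\<close>

lemma integral_scale_measure:
  fixes f :: "'b \<Rightarrow> real"
  assumes f: "f \<in> borel_measurable M" and c: "c \<ge> 0"
  shows "(LINT y|scale_measure (ennreal c) M. f y) = c * (LINT y|M. f y)"
proof -
  have "scale_measure (ennreal c) M = density M (\<lambda>_. ennreal c)"
    by (rule measure_eqI) (auto simp: emeasure_density_const)
  then have "(LINT y|scale_measure (ennreal c) M. f y) = (LINT y|M. c *\<^sub>R f y)"
    using f c by (simp add: integral_density)
  then show ?thesis by simp
qed

lemma volume_mean_eq_unit_ball:
  fixes v :: "'a::euclidean_space \<Rightarrow> real"
  assumes v: "v \<in> borel_measurable borel" and r: "r > 0"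
  shows "volume_mean v x r =
    (LINT y|restrict_space lborel (ball 0 1). v (x + r *\<^sub>R y)) / unit_ball_vol (real DIM('a))"
proof -
  have "(\<lambda>y. indicator (ball x r) y *\<^sub>R v y) \<in> borel_measurable borel"
    using v by (intro borel_measurable_scaleR borel_measurable_indicator) auto
  then have "(LINT y:ball x r|lborel. v y)
      = r ^ DIM('a) * (LINT y|lborel. indicator (ball x r) (x + r *\<^sub>R y) *\<^sub>R v (x + r *\<^sub>R y))"
    unfolding set_lebesgue_integral_def using r by (rule integral_lborel_scale)
  also have "(\<lambda>y. indicator (ball x r) (x + r *\<^sub>R y) *\<^sub>R v (x + r *\<^sub>R y))
      = (\<lambda>y. indicator (ball 0 1) y *\<^sub>R v (x + r *\<^sub>R y))"
    using r by (auto simp: indicator_def dist_norm fun_eq_iff)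
  finally show ?thesis
    using r by (simp add: volume_mean_def content_ball integral_restrict_space)
qed

lemma spherical_mean_eq_unit_ball:
  fixes v :: "'a::euclidean_space \<Rightarrow> real"
  assumes v: "v \<in> borel_measurable borel" and r: "r > 0"
  shows "spherical_mean v x r =
    (LINT y|restrict_space lborel (ball 0 1). v (x + r *\<^sub>R sgn y)) / unit_ball_vol (real DIM('a))"
proof -
  define c where "c = real DIM('a) * r ^ (DIM('a) - 1)"
  have c: "c > 0" using r by (simp add: c_def)
  have vS: "v \<in> borel_measurable (restrict_space borel (sphere x r))"
    using v by (rule measurable_restrict_space1)
  have "(LINT y|sphere_measure x r. v y) = c *
      (LINT y|distr (restrict_space lborel (ball 0 1 - {0})) (restrict_space borel (sphere x r))
        (\<lambda>y. x + r *\<^sub>R sgn y). v y)"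
    unfolding sphere_measure_def c_def[symmetric]
    using vS c by (intro integral_scale_measure) auto
  also have "\<dots> = c * (LINT y|restrict_space lborel (ball 0 1 - {0}). v (x + r *\<^sub>R sgn y))"
    by (simp only: integral_distr[OF measurable_sphere_projection[OF r] vS])
  \<comment> \<open>The centre, where \<open>sgn\<close> vanishes and the projection leaves the sphere, is a null set.\<close>
  also have "(LINT y|restrict_space lborel (ball 0 1 - {0}). v (x + r *\<^sub>R sgn y))
      = (LINT y|restrict_space lborel (ball 0 1). v (x + r *\<^sub>R sgn y))"
    by (subst (1 2) integral_restrict_space)
       (auto intro!: integral_discrete_difference[where X = "{0}"] simp: indicator_def of_bool_def split: if_splits)
  finally have int: "(LINT y|sphere_measure x r. v y)
      = c * (LINT y|restrict_space lborel (ball 0 1). v (x + r *\<^sub>R sgn y))" .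
  have "measure (sphere_measure x r) (sphere x r) = c * unit_ball_vol (real DIM('a))"
    by (simp add: measure_sphere_measure_sphere[OF r] c_def)
  then show ?thesis
    using c by (simp only: spherical_mean_def int) simp
qed

section \<open>The limits for twice continuously differentiable functions\<close>

text \<open>Combines the expansion for isotropic averages with the moments of a radial field, normalised by the
volume \<open>\<omega>\<close> of the unit ball; \<open>s\<close> is the average of the squared norm of the field.\<close>

lemma radial_mean_limit:
  fixes v :: "'a::euclidean_space \<Rightarrow> real" and g :: "real \<Rightarrow> real"
  defines "M \<equiv> restrict_space lborel (ball 0 1 :: 'a set)"
    and "\<omega> \<equiv> unit_ball_vol (real DIM('a))"
  assumes v: "v \<in> borel_measurable borel" and g[measurable]: "g \<in> borel_measurable borel"
    and bound: "\<And>y::'a. norm y < 1 \<Longrightarrow> norm (g (norm y) *\<^sub>R y) \<le> 1"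
    and taylor: "\<And>e. e > 0 \<Longrightarrow> \<exists>d>0. \<forall>h. norm h \<le> d \<longrightarrow>
      \<bar>v (x + h) - v x - (\<Sum>b\<in>Basis. (h \<bullet> b) * p b)
        - (\<Sum>b\<in>Basis. \<Sum>c\<in>Basis. (h \<bullet> b) * (h \<bullet> c) * q b c) / 2\<bar> \<le> e * (norm h)\<^sup>2"
    and I: "(LINT y|M. (norm (g (norm y) *\<^sub>R y))\<^sup>2) = \<omega> * s"
  shows "((\<lambda>r. ((LINT y|M. v (x + r *\<^sub>R (g (norm y) *\<^sub>R y))) / \<omega> - v x) / r\<^sup>2)
    \<longlongrightarrow> s * (\<Sum>b\<in>Basis. q b b) / (2 * real DIM('a))) (at_right 0)"
proof -
  have \<omega>: "\<omega> > 0" by (simp add: \<omega>_def)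
  have vol: "measure M (space M) = \<omega>"
    by (simp add: M_def \<omega>_def space_restrict_space measure_restrict_space content_ball)
  have "finite_measure M"
    unfolding M_def
    by (rule finite_measureI) (auto simp: space_restrict_space emeasure_restrict_space emeasure_ball)
  moreover have "(\<lambda>y. g (norm y) *\<^sub>R y) \<in> borel_measurable M"
    unfolding M_def by (rule measurable_restrict_space1) simp
  moreover have "norm (g (norm y) *\<^sub>R y) \<le> 1" if "y \<in> space M" for y
    using that by (intro bound) (simp add: M_def space_restrict_space)
  ultimately have "((\<lambda>r. ((LINT y|M. v (x + r *\<^sub>R (g (norm y) *\<^sub>R y))) - measure M (space M) * v x) / r\<^sup>2)
      \<longlongrightarrow> (\<omega> * s / real DIM('a)) / 2 * (\<Sum>b\<in>Basis. q b b)) (at_right 0)"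
    using v radial_moments[OF g bound, folded M_def, unfolded I] taylor
    by (intro isotropic_mean_expansion) auto
  then have "((\<lambda>r. ((LINT y|M. v (x + r *\<^sub>R (g (norm y) *\<^sub>R y))) - \<omega> * v x) / r\<^sup>2 / \<omega>)
      \<longlongrightarrow> (\<omega> * s / real DIM('a)) / 2 * (\<Sum>b\<in>Basis. q b b) / \<omega>) (at_right 0)"
    unfolding vol using \<omega> by (intro tendsto_divide tendsto_const) auto
  moreover have "(A - \<omega> * z) / r\<^sup>2 / \<omega> = (A / \<omega> - z) / r\<^sup>2" for A z r :: real
    using \<omega> by (simp add: diff_divide_distrib)
  moreover have "(\<omega> * s / real DIM('a)) / 2 * (\<Sum>b\<in>Basis. q b b) / \<omega>
      = s * (\<Sum>b\<in>Basis. q b b) / (2 * real DIM('a))"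
    using \<omega> by simp
  ultimately show ?thesis by simp
qed

text \<open>The volume mean belongs to the radial field \<open>y\<close>, where \<open>s = m / (m + 2)\<close> with \<open>m\<close> the
dimension, and the spherical mean to \<open>sgn y\<close>, where \<open>s = 1\<close> since \<open>sgn y\<close> is a unit vector except at the centre.\<close>

lemma mean_limits_C2:
  fixes u :: "'a::euclidean_space \<Rightarrow> real"
  assumes D: "open D" "x \<in> D" and u: "C2_on D u"
  shows "((\<lambda>r. (volume_mean u x r - u x) / r\<^sup>2)
      \<longlongrightarrow> laplacian u x / (2 * (real DIM('a) + 2))) (at_right 0)" (is ?volume)
    and "((\<lambda>r. (spherical_mean u x r - u x) / r\<^sup>2)
      \<longlongrightarrow> laplacian u x / (2 * real DIM('a))) (at_right 0)" (is ?spherical)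
proof -
  obtain R where R: "R > 0" "cball x R \<subseteq> D"
    using D open_contains_cball by blast
  \<comment> \<open>Outside \<open>D\<close> the function \<open>u\<close> is arbitrary, possibly not measurable;
    the cut-off \<open>v\<close> is Borel measurable and has the same means around \<open>x\<close> for small radii.\<close>
  define v where "v y = indicator (cball x R) y *\<^sub>R u y" for y
  have diff: "u differentiable_on D"
    "\<And>b. b \<in> Basis \<Longrightarrow> partial_deriv b u differentiable (at x)"
    using u D unfolding C2_on_def differentiable_on_def by (metis at_within_open)+
  have cont: "continuous_on (cball x R) u"
    using differentiable_imp_continuous_on[OF diff(1)] R(2) by (rule continuous_on_subset)
  have v: "v \<in> borel_measurable borel"
    unfolding v_def using cont by (intro borel_measurable_continuous_on_indicator) auto
  have vx: "v (x + h) = u (x + h)" if "norm h \<le> R" for h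
    using that by (simp add: v_def dist_norm)
  have vx0: "v x = u x" using vx[of 0] R by simp
  have taylor: "\<exists>d>0. \<forall>h. norm h \<le> d \<longrightarrow>
    \<bar>v (x + h) - v x - (\<Sum>b\<in>Basis. (h \<bullet> b) * partial_deriv b u x)
      - (\<Sum>b\<in>Basis. \<Sum>c\<in>Basis. (h \<bullet> b) * (h \<bullet> c) * partial_deriv c (partial_deriv b u) x) / 2\<bar>
      \<le> e * (norm h)\<^sup>2" if e: "e > 0" for e
  proof -
    from second_order_taylor[OF D diff e] obtain d where d: "d > 0" "\<forall>h. norm h \<le> d \<longrightarrow>
      \<bar>u (x + h) - u x - (\<Sum>b\<in>Basis. (h \<bullet> b) * partial_deriv b u x)
        - (\<Sum>b\<in>Basis. \<Sum>c\<in>Basis. (h \<bullet> b) * (h \<bullet> c) * partial_deriv c (partial_deriv b u) x) / 2\<bar>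
        \<le> e * (norm h)\<^sup>2" by blast
    show ?thesis
    proof (intro exI[of _ "min d R"] conjI allI impI)
      show "min d R > 0" using d R by simp
      fix h :: 'a assume h: "norm h \<le> min d R"
      then show "\<bar>v (x + h) - v x - (\<Sum>b\<in>Basis. (h \<bullet> b) * partial_deriv b u x)
        - (\<Sum>b\<in>Basis. \<Sum>c\<in>Basis. (h \<bullet> b) * (h \<bullet> c) * partial_deriv c (partial_deriv b u) x) / 2\<bar>
        \<le> e * (norm h)\<^sup>2"
        unfolding vx0 using vx[of h] d(2) by simp
    qed
  qed
  have small: "\<forall>\<^sub>F r in at_right 0. 0 < r \<and> r < R"
    using R by (intro eventually_at_rightI[of 0 R]) auto
  have lap: "laplacian u x = (\<Sum>b\<in>Basis. partial_deriv b (partial_deriv b u) x)"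
    by (simp add: laplacian_def)
  define \<omega> where "\<omega> = unit_ball_vol (real DIM('a))"
  let ?M = "restrict_space lborel (ball 0 1 :: 'a set)"

  have ball_limit: "((\<lambda>r. ((LINT y|?M. v (x + r *\<^sub>R (1 *\<^sub>R y))) / \<omega> - v x) / r\<^sup>2)
      \<longlongrightarrow> (real DIM('a) / (real DIM('a) + 2)) * laplacian u x / (2 * real DIM('a))) (at_right 0)"
    unfolding \<omega>_def lap
    by (rule radial_mean_limit[OF v _ _ taylor])
       (auto simp: integral_norm_square_ball)
  have ball_value: "(real DIM('a) / (real DIM('a) + 2)) * laplacian u x / (2 * real DIM('a))
      = laplacian u x / (2 * (real DIM('a) + 2))"
    by (simp add: divide_simps)
  have "\<forall>\<^sub>F r in at_right 0. ((LINT y|?M. v (x + r *\<^sub>R (1 *\<^sub>R y))) / \<omega> - v x) / r\<^sup>2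
      = (volume_mean u x r - u x) / r\<^sup>2"
    using small
  proof eventually_elim
    case (elim r)
    have "volume_mean u x r = volume_mean v x r"
      unfolding volume_mean_def using elim
      by (intro arg_cong2[where f = "(/)"] set_lebesgue_integral_cong) (auto simp: v_def)
    then show ?case
      using volume_mean_eq_unit_ball[OF v, of r x] elim by (simp add: vx0 \<omega>_def)
  qed
  then show ?volume
    by (rule Lim_transform_eventually[OF ball_limit[unfolded ball_value]])

  \<comment> \<open>At \<open>y = 0\<close> both sides are zero, so the function \<open>inverse\<close> serves as \<open>g\<close> on the whole ball.\<close>
  have sgn: "inverse (norm y) *\<^sub>R y = sgn y" for y :: 'a
    by (simp add: sgn_div_norm)
  have "(LINT y|?M. (norm (sgn y))\<^sup>2) = (LINT y|?M. 1)"
  proof -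
    have restrict: "(LINT y|?M. f y) = (LINT y|lborel. indicator (ball 0 1) y *\<^sub>R f y)" for f :: "'a \<Rightarrow> real"
      by (rule integral_restrict_space) simp
    show ?thesis
      unfolding restrict by (rule integral_discrete_difference[where X = "{0}"]) (auto simp: norm_sgn)
  qed
  also have "\<dots> = \<omega> * 1"
    by (simp add: \<omega>_def space_restrict_space measure_restrict_space content_ball)
  finally have sphere_limit: "((\<lambda>r. ((LINT y|?M. v (x + r *\<^sub>R (inverse (norm y) *\<^sub>R y))) / \<omega> - v x) / r\<^sup>2)
      \<longlongrightarrow> 1 * laplacian u x / (2 * real DIM('a))) (at_right 0)"
    unfolding \<omega>_def lap
    by (intro radial_mean_limit[OF v _ _ taylor]) (simp_all only: sgn, auto simp: norm_sgn)
  have "\<forall>\<^sub>F r in at_right 0. ((LINT y|?M. v (x + r *\<^sub>R (inverse (norm y) *\<^sub>R y))) / \<omega> - v x) / r\<^sup>2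
      = (spherical_mean u x r - u x) / r\<^sup>2"
    using small
  proof eventually_elim
    case (elim r)
    have "spherical_mean u x r = spherical_mean v x r"
      unfolding spherical_mean_def using elim
      by (intro arg_cong2[where f = "(/)"] Bochner_Integration.integral_cong) (auto simp: v_def)
    then show ?case
      using spherical_mean_eq_unit_ball[OF v, of r x] elim by (simp add: vx0 \<omega>_def sgn)
  qed
  then show ?spherical
    by (rule Lim_transform_eventually[OF sphere_limit[unfolded mult_1_left]])
qed

theorem proposition2p1:
  fixes D :: "'a::euclidean_space set" and u :: "'a \<Rightarrow> real" and \<mu> :: real
  assumes "DIM('a) \<ge> 2"
    and "\<mu> \<noteq> 0"
    and "open D" and "connected D"
    and "panharmonic \<mu> D u"
  shows "(\<forall>x\<in>D. ((\<lambda>r. (volume_mean u x r - u x) / r\<^sup>2)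
              \<longlongrightarrow> \<mu>\<^sup>2 * u x / (2 * (real DIM('a) + 2))) (at_right 0)) \<and>
         (\<forall>x\<in>D. ((\<lambda>r. (spherical_mean u x r - u x) / r\<^sup>2)
              \<longlongrightarrow> \<mu>\<^sup>2 * u x / (2 * real DIM('a))) (at_right 0))"
proof -
  have u: "C2_on D u" and lap: "\<And>x. x \<in> D \<Longrightarrow> laplacian u x = \<mu>\<^sup>2 * u x"
    using assms(5) by (auto simp: panharmonic_def)
  show ?thesis
    using mean_limits_C2[OF \<open>open D\<close> _ u] lap by simp
qed

end
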